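(* Let $(\alpha,h)\in(-2,+\infty)\times\mathbb{R}$ and let $f_{\alpha,h}$ be the infinite volume free energy of the edge-triangle model, i.e. $f_{\alpha,h}=\sup_{0\le u\le1}\left(\frac\alpha6u^3+\frac h2u-\frac12I(u)\right)$. Then $$\lim_{n\to+\infty}\bar f_{n;\alpha,h}=f_{\alpha,h}.$$
   Context: Mean-field model. For $n\in\mathbb{N}$ let $\mathcal{E}_n$ be the edge set of the complete graph on $n$ labeled vertices (so $|\mathcal{E}_n|=\binom n2$) and $\mathcal{A}_n=\{0,1\}^{\mathcal{E}_n}$. For $\alpha,h\in\mathbb{R}$ and $x\in\mathcal{A}_n$ set $\bar{\mathcal{H}}_{n;\alpha,h}(x)=\frac{4\alpha}{3n^4}\left(\sum_{i\in\mathcal{E}_n}x_i\right)^3+h\sum_{i\in\mathcal{E}_n}x_i$, $\bar Z_{n;\alpha,h}=\sum_{x\in\mathcal{A}_n}e^{\bar{\mathcal{H}}_{n;\alpha,h}(x)}$ and $\bar f_{n;\alpha,h}=\frac1{n^2}\ln\bar Z_{n;\alpha,h}$. Also $I(u)=u\ln u+(1-u)\ln(1-u)$ on $[0,1]$ (with $0\ln0=0$). (For reference: the edge-triangle model has Hamiltonian $\frac{\alpha}{n}\sum_{\{i,j,k\}\in\mathcal{T}_n}x_ix_jx_k+h\sum_{i\in\mathcal{E}_n}x_i$, with $\mathcal{T}_n$ the set of triangles, and it is known that for $\alpha>-2$ the limit of $n^{-2}$ times the logarithm of its partition function is $\sup_{0\le u\le1}\left(\frac\alpha6u^3+\frac h2u-\frac12I(u)\right)$.)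 *)

theory Defs
  imports Complex_Main "HOL-Library.FuncSet"
begin

definition edges :: "nat \<Rightarrow> nat set set" where
  "edges n = {e. e \<subseteq> {1..n} \<and> card e = 2}"

text \<open>Configurations are extensional functions on the edge set, so that each element of
  \<open>{0,1}\<close> to the power of the edge set is represented by exactly one function.\<close>

definition configs :: "nat \<Rightarrow> (nat set \<Rightarrow> nat) set" where
  "configs n = edges n \<rightarrow>\<^sub>E {0, 1}"

definition mf_hamiltonian :: "nat \<Rightarrow> real \<Rightarrow> real \<Rightarrow> (nat set \<Rightarrow> nat) \<Rightarrow> real" where
  "mf_hamiltonian n \<alpha> h x =
     4 * \<alpha> / (3 * real n ^ 4) * (\<Sum>i\<in>edges n. real (x i)) ^ 3 + h * (\<Sum>i\<in>edges n. real (x i))"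

definition mf_partition :: "nat \<Rightarrow> real \<Rightarrow> real \<Rightarrow> real" where
  "mf_partition n \<alpha> h = (\<Sum>x\<in>configs n. exp (mf_hamiltonian n \<alpha> h x))"

definition mf_free_energy :: "nat \<Rightarrow> real \<Rightarrow> real \<Rightarrow> real" where
  "mf_free_energy n \<alpha> h = 1 / real n ^ 2 * ln (mf_partition n \<alpha> h)"

text \<open>The convention \<open>0 ln 0 = 0\<close> at both endpoints holds because multiplication by \<open>0\<close>
  gives \<open>0\<close> whatever the value of \<open>ln 0\<close>.\<close>

definition entropy_fun :: "real \<Rightarrow> real" where
  "entropy_fun u = u * ln u + (1 - u) * ln (1 - u)"

text \<open>The infinite volume free energy of the edge-triangle model, given by its variational
  formula (valid for \<open>\<alpha> > -2\<close>). The supremum is over a nonempty set that is bounded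
  above, so the conditionally complete \<open>Sup\<close> on the reals is the true supremum.\<close>

definition free_energy :: "real \<Rightarrow> real \<Rightarrow> real" where
  "free_energy \<alpha> h = (SUP u\<in>{0..1}. \<alpha> / 6 * u ^ 3 + h / 2 * u - 1 / 2 * entropy_fun u)"

end

theory Submission
  imports Defs "HOL-Analysis.Weierstrass_Theorems" "HOL-Real_Asymp.Real_Asymp"
begin

text \<open>
  The Hamiltonian depends on a configuration only through its number \<open>k\<close> of edges, so with
  \<open>N = n(n-1)/2\<close> the partition function is \<open>\<Sum>k\<le>N. (N choose k) * exp (c * k^3 + h * k)\<close>, where
  \<open>c = 4\<alpha>/(3n^4)\<close>. For \<open>k = N u\<close>, the binomial coefficient contributes \<open>-N I(u)\<close> to the exponent (\<open>I\<close> is \<open>entropy_fun\<close>),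
  and since \<open>N\<close> is close to \<open>n^2/2\<close> the whole exponent is close to
  \<open>n^2 (\<alpha>/6 u^3 + h/2 u - I(u)/2)\<close>. The sum has only \<open>N + 1\<close> terms, so its logarithm is governed
  by the largest one.

  The upper bound (\<open>ln_cubic_binomial_sum_le\<close>) bounds every term by the supremum, using
  \<open>(N choose k) \<le> exp (-N I(k/N))\<close>; the number of terms costs \<open>ln (N + 1)\<close>.
  The lower bound (\<open>ln_cubic_binomial_sum_ge\<close>) is the Gibbs variational principle with the binomial
  law of parameter \<open>p\<close> as trial measure: by Jensen's inequality the logarithm of the sum is at
  least the mean energy plus the entropy \<open>-N I(p)\<close>. The mean of \<open>k^3\<close> differs from \<open>(N p)^3\<close> by
  at most \<open>3 N^2\<close>, which after multiplication by \<open>c\<close> is a bounded error. Such a lower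
  bound holds for every \<open>p\<close> in \<open>[0,1]\<close>, hence for the supremum.

  Both errors vanish after division by \<open>n^2\<close>, and replacing \<open>N/n^2\<close> by \<open>1/2\<close> changes the
  functional uniformly little because \<open>I\<close> is bounded on \<open>[0,1]\<close>.
\<close>

section \<open>Counting configurations by their number of edges\<close>

lemma sum_configurations_eq_sum_binomial:
  fixes g :: "real \<Rightarrow> real"
  assumes fin: "finite E"
  shows "(\<Sum>x\<in>E \<rightarrow>\<^sub>E {0, 1::nat}. g (\<Sum>i\<in>E. real (x i)))
       = (\<Sum>k\<le>card E. real (card E choose k) * g (real k))"
proof -
  have count: "(\<Sum>i\<in>E. real (x i)) = real (card {i\<in>E. x i = 1})"
    if "x \<in> E \<rightarrow>\<^sub>E {0, 1::nat}" for x
  proof -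
    have "(\<Sum>i\<in>E. real (x i)) = (\<Sum>i\<in>E. if x i = 1 then 1 else 0)"
      using that by (intro sum.cong) (auto simp: PiE_iff)
    also have "\<dots> = real (card {i\<in>E. x i = 1})"
      using fin by (simp add: sum.If_cases Int_def)
    finally show ?thesis .
  qed
  have "(\<Sum>x\<in>E \<rightarrow>\<^sub>E {0, 1::nat}. g (\<Sum>i\<in>E. real (x i)))
      = (\<Sum>x\<in>E \<rightarrow>\<^sub>E {0, 1::nat}. g (real (card {i\<in>E. x i = 1})))"
    by (intro sum.cong) (auto simp: count)
  also have "\<dots> = (\<Sum>A\<in>Pow E. g (real (card A)))"
    by (rule sum.reindex_bij_witness[where
          i = "\<lambda>A. \<lambda>e\<in>E. if e \<in> A then 1 else 0" and j = "\<lambda>x. {i\<in>E. x i = 1}"])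
      (auto simp: fun_eq_iff PiE_iff extensional_def restrict_def split: if_splits)
  also have "\<dots> = (\<Sum>k\<le>card E. \<Sum>A\<in>{A \<in> Pow E. card A = k}. g (real (card A)))"
    using fin by (intro sum.group[symmetric]) (auto simp: card_mono)
  also have "\<dots> = (\<Sum>k\<le>card E. real (card E choose k) * g (real k))"
    using fin by (intro sum.cong) (auto simp: n_subsets)
  finally show ?thesis .
qed

lemma finite_edges: "finite (edges n)"
  by (rule finite_subset[of _ "Pow {1..n}"]) (auto simp: edges_def)

lemma real_card_edges: "real (card (edges n)) = real n * (real n - 1) / 2"
proof -
  have "card (edges n) = n choose 2"
    using n_subsets[of "{1..n}" 2] by (simp add: edges_def)
  then show ?thesis
    by (cases n) (simp_all add: choose_two real_of_nat_div algebra_simps)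
qed

lemma mf_partition_eq_sum_binomial:
  "mf_partition n \<alpha> h = (\<Sum>k\<le>card (edges n). real (card (edges n) choose k)
     * exp (4 * \<alpha> / (3 * real n ^ 4) * real k ^ 3 + h * real k))"
  unfolding mf_partition_def mf_hamiltonian_def configs_def
  by (rule sum_configurations_eq_sum_binomial
        [where g = "\<lambda>s. exp (4 * \<alpha> / (3 * real n ^ 4) * s ^ 3 + h * s)", OF finite_edges])

section \<open>Entropy bounds\<close>

text \<open>The constant \<open>-1\<close> is cruder than the minimum \<open>-ln 2\<close>, but it follows directly from
  \<open>ln v \<ge> 1 - 1/v\<close>, that is, \<open>v ln v \<ge> v - 1\<close>, applied to \<open>u\<close> and to \<open>1 - u\<close>.\<close>

lemma entropy_fun_bounds:
  assumes "u \<in> {0..1}"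
  shows "-1 \<le> entropy_fun u" "entropy_fun u \<le> 0"
proof -
  have *: "v - 1 \<le> v * ln v \<and> v * ln v \<le> 0" if "v \<in> {0..1}" for v :: real
  proof (cases "v = 0")
    case False
    then have v: "v > 0" "v \<le> 1" using that by auto
    have "- ln v \<le> 1 / v - 1"
      using ln_le_minus_one[of "1 / v"] v by (simp add: ln_div)
    then have "v * (- ln v) \<le> v * (1 / v - 1)"
      using v by (intro mult_left_mono) auto
    then show ?thesis
      using v by (auto simp: right_diff_distrib mult_nonneg_nonpos)
  qed auto
  show "-1 \<le> entropy_fun u" "entropy_fun u \<le> 0"
    using *[of u] *[of "1 - u"] assms by (auto simp: entropy_fun_def)
qed

lemma exp_mult_ln_eq_power:
  fixes p :: real
  assumes "p > 0 \<or> k = 0" "p \<ge> 0"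
  shows "exp (real k * ln p) = p ^ k"
  using assms by (auto simp: exp_of_nat_mult)

text \<open>This is an equality for \<open>p > 0\<close>. At \<open>p = 0\<close>, where \<open>ln 0 = 0\<close>, it remains true as an
  inequality, so that the variational lower bound below covers the endpoints of \<open>[0,1]\<close> without a
  separate argument.\<close>

lemma power_mult_exp_neg_le_1:
  fixes p :: real
  assumes "p \<ge> 0"
  shows "p ^ k * exp (- (real k * ln p)) \<le> 1"
proof (cases "p > 0")
  case True
  then show ?thesis by (simp add: exp_minus exp_of_nat_mult)
next
  case False
  with assms have "p = 0" by simp
  then show ?thesis by (simp add: power_0_left)
qed

text \<open>A binomial variable with parameters \<open>N\<close> and \<open>k/N\<close> takes the value \<open>k\<close> with probability
  \<open>(N choose k) * exp (N I(k/N))\<close>, and a probability is at most \<open>1\<close>. The Bernstein polynomials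
  serve as the binomial probabilities, here and below.\<close>

lemma binomial_le_exp_entropy:
  assumes "k \<le> N" "N > 0"
  shows "real (N choose k) \<le> exp (- (real N * entropy_fun (real k / real N)))"
proof -
  define p where "p = real k / real N"
  have p: "0 \<le> p" "p \<le> 1" using assms by (auto simp: p_def)
  have Np: "real N * p = real k" "real N * (1 - p) = real (N - k)"
    using assms by (auto simp: p_def field_simps of_nat_diff)
  have "real N * entropy_fun p = real N * p * ln p + real N * (1 - p) * ln (1 - p)"
    by (simp add: entropy_fun_def algebra_simps)
  then have ent: "real N * entropy_fun p = real k * ln p + real (N - k) * ln (1 - p)"
    by (simp only: Np)
  have pk: "exp (real k * ln p) = p ^ k"
    using p assms by (intro exp_mult_ln_eq_power) (auto simp: p_def)
  have qk: "exp (real (N - k) * ln (1 - p)) = (1 - p) ^ (N - k)"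
    using p assms by (intro exp_mult_ln_eq_power) (auto simp: p_def)
  have "Bernstein N k p \<le> (\<Sum>j\<le>N. Bernstein N j p)"
    using assms p by (intro member_le_sum) (auto simp: Bernstein_nonneg)
  then have "Bernstein N k p \<le> 1" by simp
  then have "real (N choose k) * exp (real N * entropy_fun p) \<le> 1"
    by (simp add: Bernstein_def ent exp_add pk qk mult.assoc)
  then show ?thesis
    by (simp add: exp_minus field_simps p_def)
qed

section \<open>Two-sided bounds at finite size\<close>

text \<open>Averages the tangent line inequality \<open>exp y \<ge> exp m * (1 + (y - m))\<close> at the mean \<open>m\<close>; the
  linear term has average zero.\<close>

lemma Jensen_exp:
  fixes w y :: "'a \<Rightarrow> real"
  assumes "\<And>k. k \<in> A \<Longrightarrow> w k \<ge> 0" "(\<Sum>k\<in>A. w k) = 1"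
  shows "exp (\<Sum>k\<in>A. w k * y k) \<le> (\<Sum>k\<in>A. w k * exp (y k))"
proof -
  define m where "m = (\<Sum>k\<in>A. w k * y k)"
  have "exp m = exp m * (\<Sum>k\<in>A. w k * (1 + (y k - m)))"
    using assms(2) by (simp add: algebra_simps sum.distrib sum_subtractf m_def
        flip: sum_distrib_left sum_distrib_right)
  also have "\<dots> = (\<Sum>k\<in>A. w k * (exp m * (1 + (y k - m))))"
    by (simp add: sum_distrib_left mult_ac)
  also have "\<dots> \<le> (\<Sum>k\<in>A. w k * (exp m * exp (y k - m)))"
    using assms(1) by (intro sum_mono mult_left_mono exp_ge_add_one_self) auto
  also have "\<dots> = (\<Sum>k\<in>A. w k * exp (y k))"
    by (simp flip: exp_add)
  finally show ?thesis by (simp add: m_def)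
qed

lemma Bernstein_variance:
  "(\<Sum>k\<le>N. (real k - real N * p)\<^sup>2 * Bernstein N k p) = real N * p * (1 - p)"
proof -
  have "(\<Sum>k\<le>N. (real k - real N * p)\<^sup>2 * Bernstein N k p)
      = (\<Sum>k\<le>N. real k * (real k - 1) * Bernstein N k p)
        + (1 - 2 * real N * p) * (\<Sum>k\<le>N. real k * Bernstein N k p)
        + (real N * p)\<^sup>2 * (\<Sum>k\<le>N. Bernstein N k p)"
    unfolding sum_distrib_left sum.distrib[symmetric]
    by (intro sum.cong) (auto simp: algebra_simps power2_eq_square)
  also have "\<dots> = real N * p * (1 - p)"
    unfolding sum_Bernstein sum_k_Bernstein sum_kk_Bernstein
    by (simp add: algebra_simps power2_eq_square)
  finally show ?thesis .
qed

text \<open>With \<open>m = N p\<close>, the identity \<open>k^3 - m^3 - 3 m^2 (k - m) = (k - m)^2 (k + 2m)\<close> reduces the third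
  moment to the variance: the linear term averages to zero and \<open>k + 2m \<le> 3N\<close>.\<close>

lemma Bernstein_third_moment:
  assumes p: "0 \<le> p" "p \<le> 1"
  shows "\<bar>(\<Sum>k\<le>N. real k ^ 3 * Bernstein N k p) - (real N * p) ^ 3\<bar> \<le> 3 * (real N)\<^sup>2"
proof -
  define m where "m = real N * p"
  have m: "0 \<le> m" "m \<le> real N"
    using p by (auto simp: m_def mult_left_le)
  have "(\<Sum>k\<le>N. real k ^ 3 * Bernstein N k p)
      = (\<Sum>k\<le>N. (real k - m)\<^sup>2 * (real k + 2 * m) * Bernstein N k p)
        + 3 * m\<^sup>2 * (\<Sum>k\<le>N. real k * Bernstein N k p)
        - 2 * m ^ 3 * (\<Sum>k\<le>N. Bernstein N k p)"
    unfolding sum_distrib_left sum.distrib[symmetric] sum_subtractf[symmetric]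
    by (intro sum.cong) (auto simp: algebra_simps power2_eq_square power3_eq_cube)
  also have "\<dots> = (\<Sum>k\<le>N. (real k - m)\<^sup>2 * (real k + 2 * m) * Bernstein N k p) + m ^ 3"
    unfolding sum_Bernstein sum_k_Bernstein m_def[symmetric]
    by (simp add: power2_eq_square power3_eq_cube)
  finally have eq: "(\<Sum>k\<le>N. real k ^ 3 * Bernstein N k p) - m ^ 3
      = (\<Sum>k\<le>N. (real k - m)\<^sup>2 * (real k + 2 * m) * Bernstein N k p)" by simp
  have nonneg: "0 \<le> (\<Sum>k\<le>N. (real k - m)\<^sup>2 * (real k + 2 * m) * Bernstein N k p)"
    using p m by (intro sum_nonneg) (auto simp: Bernstein_nonneg)
  have "(\<Sum>k\<le>N. (real k - m)\<^sup>2 * (real k + 2 * m) * Bernstein N k p)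
      \<le> (\<Sum>k\<le>N. (real k - m)\<^sup>2 * (3 * real N) * Bernstein N k p)"
    using p m by (intro sum_mono mult_right_mono mult_left_mono) (auto simp: Bernstein_nonneg)
  also have "\<dots> = 3 * real N * (real N * p * (1 - p))"
    unfolding Bernstein_variance[symmetric] m_def sum_distrib_left
    by (intro sum.cong) (auto simp: mult_ac)
  also have "\<dots> = 3 * (real N)\<^sup>2 * (p * (1 - p))"
    by (simp add: power2_eq_square)
  also have "\<dots> \<le> 3 * (real N)\<^sup>2 * 1"
    using p by (intro mult_left_mono mult_le_one) auto
  finally show ?thesis
    using eq nonneg by (simp add: m_def)
qed

text \<open>Each binomial coefficient times a Boltzmann weight is at least the binomial probability of \<open>k\<close>
  times the exponential of energy minus log-probability. Jensen's inequality moves the average into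
  the exponent, where only the cubic term has a mean that is not explicit in \<open>N p\<close>; its error is
  the summand \<open>3 * \<bar>c\<bar> * N^2\<close>.\<close>

lemma ln_cubic_binomial_sum_ge:
  assumes p: "p \<in> {0..1}"
  shows "c * (real N * p) ^ 3 + h * (real N * p) - real N * entropy_fun p - 3 * \<bar>c\<bar> * (real N)\<^sup>2
    \<le> ln (\<Sum>k\<le>N. real (N choose k) * exp (c * real k ^ 3 + h * real k))"
    (is "?L \<le> ln ?Z")
proof -
  \<comment> \<open>Energy minus the logarithm of the probability of a single configuration with \<open>k\<close> edges;
    its mean under the binomial law is the free energy of the trial measure.\<close>
  define y where "y k = c * real k ^ 3 + h * real k
    - real k * ln p - (real N - real k) * ln (1 - p)" for k
  have p01: "0 \<le> p" "p \<le> 1" using p by auto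
  define M where "M = (\<Sum>k\<le>N. real k ^ 3 * Bernstein N k p)"
  have "(\<Sum>k\<le>N. Bernstein N k p * y k)
      = c * M + (h - ln p + ln (1 - p)) * (\<Sum>k\<le>N. real k * Bernstein N k p)
        - real N * ln (1 - p) * (\<Sum>k\<le>N. Bernstein N k p)"
    unfolding M_def sum_distrib_left sum.distrib[symmetric] sum_subtractf[symmetric]
    by (intro sum.cong) (auto simp: y_def algebra_simps)
  also have "\<dots> = c * M + h * (real N * p) - real N * entropy_fun p"
    unfolding sum_Bernstein sum_k_Bernstein by (simp add: entropy_fun_def algebra_simps)
  finally have mean: "(\<Sum>k\<le>N. Bernstein N k p * y k)
      = c * M + h * (real N * p) - real N * entropy_fun p" .
  have "\<bar>c * (M - (real N * p) ^ 3)\<bar> \<le> \<bar>c\<bar> * (3 * (real N)\<^sup>2)"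
    unfolding abs_mult M_def using Bernstein_third_moment[OF p01]
    by (intro mult_left_mono) auto
  then have "?L \<le> (\<Sum>k\<le>N. Bernstein N k p * y k)"
    unfolding mean by (simp add: algebra_simps abs_le_iff)
  then have "exp ?L \<le> exp (\<Sum>k\<le>N. Bernstein N k p * y k)"
    by simp
  also have "\<dots> \<le> (\<Sum>k\<le>N. Bernstein N k p * exp (y k))"
    using p01 by (intro Jensen_exp) (auto simp: sum_Bernstein Bernstein_nonneg)
  also have "\<dots> \<le> ?Z"
  proof (rule sum_mono)
    fix k assume "k \<in> {..N}"
    then have "exp (y k) = exp (c * real k ^ 3 + h * real k)
        * (exp (- (real k * ln p)) * exp (- (real (N - k) * ln (1 - p))))"
      by (simp add: y_def of_nat_diff flip: exp_add)
    then have "Bernstein N k p * exp (y k)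
      = real (N choose k) * exp (c * real k ^ 3 + h * real k)
        * ((p ^ k * exp (- (real k * ln p)))
           * ((1 - p) ^ (N - k) * exp (- (real (N - k) * ln (1 - p)))))"
      by (simp add: Bernstein_def mult_ac)
    also have "\<dots> \<le> real (N choose k) * exp (c * real k ^ 3 + h * real k) * 1"
      using p01 by (intro mult_left_mono mult_le_one power_mult_exp_neg_le_1) auto
    finally show "Bernstein N k p * exp (y k)
      \<le> real (N choose k) * exp (c * real k ^ 3 + h * real k)" by simp
  qed
  finally have le: "exp ?L \<le> ?Z" .
  then have "?Z > 0"
    by (rule less_le_trans[OF exp_gt_zero])
  with le show ?thesis by (simp add: ln_ge_iff)
qed

lemma ln_cubic_binomial_sum_le:
  assumes "N > 0"
    and B: "\<And>u. u \<in> {0..1} \<Longrightarrow>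
      c * (real N * u) ^ 3 + h * (real N * u) - real N * entropy_fun u \<le> B"
  shows "ln (\<Sum>k\<le>N. real (N choose k) * exp (c * real k ^ 3 + h * real k))
    \<le> ln (real N + 1) + B" (is "ln ?Z \<le> _")
proof -
  have "?Z \<le> (\<Sum>k\<le>N. exp B)"
  proof (rule sum_mono)
    fix k assume k: "k \<in> {..N}"
    define u where "u = real k / real N"
    have u: "u \<in> {0..1}" "real N * u = real k"
      using k assms(1) by (auto simp: u_def)
    have "real (N choose k) * exp (c * real k ^ 3 + h * real k)
        \<le> exp (- (real N * entropy_fun u)) * exp (c * real k ^ 3 + h * real k)"
      using k assms(1) unfolding u_def
      by (intro mult_right_mono binomial_le_exp_entropy) auto
    also have "\<dots> \<le> exp B"
      using B[OF u(1)] unfolding u(2) by (simp add: u_def flip: exp_add)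
    finally show "real (N choose k) * exp (c * real k ^ 3 + h * real k) \<le> exp B" .
  qed
  then have "?Z \<le> (real N + 1) * exp B" by (simp add: algebra_simps)
  moreover have "?Z > 0"
    by (intro sum_pos) auto
  ultimately have "ln ?Z \<le> ln ((real N + 1) * exp B)"
    by (subst ln_le_cancel_iff) auto
  then show ?thesis by (simp add: ln_mult)
qed

section \<open>The limit\<close>

lemma bdd_above_free_energy:
  fixes \<alpha> h :: real
  shows "bdd_above ((\<lambda>u. \<alpha> / 6 * u ^ 3 + h / 2 * u - 1 / 2 * entropy_fun u) ` {0..1})"
proof (rule bdd_aboveI2)
  fix u :: real assume u: "u \<in> {0..1}"
  have "\<alpha> / 6 * u ^ 3 \<le> \<bar>\<alpha>\<bar> / 6 * 1"
    using u by (intro mult_mono power_le_one) auto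
  moreover have "h / 2 * u \<le> \<bar>h\<bar> / 2 * 1"
    using u by (intro mult_mono) auto
  ultimately show "\<alpha> / 6 * u ^ 3 + h / 2 * u - 1 / 2 * entropy_fun u
      \<le> \<bar>\<alpha>\<bar> / 6 + \<bar>h\<bar> / 2 + 1 / 2"
    using entropy_fun_bounds(1)[OF u] by linarith
qed

text \<open>The parameter \<open>a\<close> stands for the ratio of the number of edges to \<open>n^2\<close>; for \<open>a = 1/2\<close> the first
  functional is the limiting one. The bound is uniform in \<open>u\<close>, so it passes to suprema.\<close>

lemma finite_size_functional_error:
  fixes \<alpha> h a u :: real
  assumes u: "u \<in> {0..1}"
  shows "\<bar>(4 * \<alpha> / 3 * a ^ 3 * u ^ 3 + h * a * u - a * entropy_fun u)
      - (\<alpha> / 6 * u ^ 3 + h / 2 * u - 1 / 2 * entropy_fun u)\<bar>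
    \<le> \<bar>4 * \<alpha> / 3 * a ^ 3 - \<alpha> / 6\<bar> + (\<bar>h\<bar> + 1) * \<bar>a - 1 / 2\<bar>" (is "\<bar>?D\<bar> \<le> _")
proof -
  define s where "s = 4 * \<alpha> / 3 * a ^ 3 - \<alpha> / 6"
  have "?D = s * u ^ 3 + h * (a - 1/2) * u - (a - 1/2) * entropy_fun u"
    by (simp add: s_def algebra_simps)
  moreover have "\<bar>s * u ^ 3\<bar> \<le> \<bar>s\<bar>"
    using u by (simp add: abs_mult mult_left_le power_le_one)
  moreover have "\<bar>h * (a - 1/2) * u\<bar> \<le> \<bar>h\<bar> * \<bar>a - 1/2\<bar>"
    using u by (simp add: abs_mult mult_left_le)
  moreover have "\<bar>(a - 1/2) * entropy_fun u\<bar> \<le> \<bar>a - 1/2\<bar>"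
    unfolding abs_mult using entropy_fun_bounds[OF u] by (intro mult_left_le) auto
  ultimately show ?thesis
    unfolding s_def[symmetric] distrib_right mult_1 by linarith
qed

text \<open>The first two summands of the bound come from replacing \<open>a\<close> by \<open>1/2\<close> in the functional; the
  term with \<open>\<bar>\<alpha>\<bar>\<close> is the third moment correction in the lower bound, and the logarithm counts the
  terms of the partition function in the upper bound.\<close>

lemma mf_free_energy_error:
  assumes n: "n \<ge> 2"
  defines "N \<equiv> real n * (real n - 1) / 2"
  defines "a \<equiv> N / (real n)\<^sup>2"
  shows "\<bar>mf_free_energy n \<alpha> h - free_energy \<alpha> h\<bar>
    \<le> \<bar>4 * \<alpha> / 3 * a ^ 3 - \<alpha> / 6\<bar> + (\<bar>h\<bar> + 1) * \<bar>a - 1 / 2\<bar>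
      + (\<bar>\<alpha>\<bar> + ln (N + 1)) / (real n)\<^sup>2"
proof -
  define \<delta> where "\<delta> = \<bar>4 * \<alpha> / 3 * a ^ 3 - \<alpha> / 6\<bar> + (\<bar>h\<bar> + 1) * \<bar>a - 1 / 2\<bar>"
  define G where "G u = \<alpha> / 6 * u ^ 3 + h / 2 * u - 1 / 2 * entropy_fun u" for u
  define c where "c = 4 * \<alpha> / (3 * real n ^ 4)"
  define K where "K = card (edges n)"
  have N: "real K = N" by (simp add: K_def N_def real_card_edges)
  have N0: "N > 0" using n by (simp add: N_def)
  then have K0: "K > 0" using N by simp
  have n0: "real n > 0" using n by simp
  have Na: "N = a * (real n)\<^sup>2" using n0 by (simp add: a_def)
  have F: "mf_free_energy n \<alpha> h = ln (\<Sum>k\<le>K. real (K choose k)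
      * exp (c * real k ^ 3 + h * real k)) / (real n)\<^sup>2"
    by (simp add: mf_free_energy_def mf_partition_eq_sum_binomial c_def K_def)
  have scale: "c * (real K * u) ^ 3 + h * (real K * u) - real K * entropy_fun u
      = (real n)\<^sup>2 * (4 * \<alpha> / 3 * a ^ 3 * u ^ 3 + h * a * u - a * entropy_fun u)" for u
    unfolding N Na c_def using n0
    by (simp add: field_simps power2_eq_square power3_eq_cube power4_eq_xxxx)
  have err: "\<bar>(c * (real K * u) ^ 3 + h * (real K * u) - real K * entropy_fun u)
      - (real n)\<^sup>2 * G u\<bar> \<le> (real n)\<^sup>2 * \<delta>" if "u \<in> {0..1}" for u
    unfolding scale right_diff_distrib[symmetric] abs_mult G_def \<delta>_def
    using finite_size_functional_error[OF that] by (simp add: mult_left_mono)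
  have fe: "free_energy \<alpha> h = (SUP u\<in>{0..1}. G u)"
    by (simp add: free_energy_def G_def)
  have G_le: "G u \<le> free_energy \<alpha> h" if "u \<in> {0..1}" for u
    unfolding fe G_def using that bdd_above_free_energy by (intro cSUP_upper) auto
  have upper: "mf_free_energy n \<alpha> h \<le> free_energy \<alpha> h + \<delta> + ln (N + 1) / (real n)\<^sup>2"
  proof -
    have "ln (\<Sum>k\<le>K. real (K choose k) * exp (c * real k ^ 3 + h * real k))
        \<le> ln (real K + 1) + (real n)\<^sup>2 * (free_energy \<alpha> h + \<delta>)"
    proof (rule ln_cubic_binomial_sum_le[OF K0])
      fix u :: real assume u: "u \<in> {0..1}"
      have "(real n)\<^sup>2 * G u \<le> (real n)\<^sup>2 * free_energy \<alpha> h"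
        using G_le[OF u] by (intro mult_left_mono) auto
      then show "c * (real K * u) ^ 3 + h * (real K * u) - real K * entropy_fun u
          \<le> (real n)\<^sup>2 * (free_energy \<alpha> h + \<delta>)"
        using err[OF u] unfolding distrib_left by linarith
    qed
    then show ?thesis
      unfolding F N using n0 by (simp add: field_simps)
  qed
  have c_err: "3 * \<bar>c\<bar> * (real K)\<^sup>2 \<le> \<bar>\<alpha>\<bar>"
  proof -
    have "N \<le> (real n)\<^sup>2 / 2"
      using n0 by (simp add: N_def power2_eq_square field_simps)
    then have "N\<^sup>2 \<le> ((real n)\<^sup>2 / 2)\<^sup>2"
      using N0 by (intro power_mono) auto
    then have "4 * N\<^sup>2 \<le> real n ^ 4"
      by (simp add: power_divide)
    then have "\<bar>\<alpha>\<bar> * (4 * N\<^sup>2) \<le> \<bar>\<alpha>\<bar> * real n ^ 4"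
      by (intro mult_left_mono) auto
    then show ?thesis
      unfolding N c_def using n0 by (simp add: abs_mult field_simps)
  qed
  have lower: "free_energy \<alpha> h \<le> mf_free_energy n \<alpha> h + \<delta> + \<bar>\<alpha>\<bar> / (real n)\<^sup>2"
    unfolding fe
  proof (rule cSUP_least)
    fix u :: real assume u: "u \<in> {0..1}"
    have "(real n)\<^sup>2 * G u
        \<le> ln (\<Sum>k\<le>K. real (K choose k) * exp (c * real k ^ 3 + h * real k))
          + (real n)\<^sup>2 * \<delta> + \<bar>\<alpha>\<bar>"
      using ln_cubic_binomial_sum_ge[OF u, of c K h] err[OF u] c_err by linarith
    then show "G u \<le> mf_free_energy n \<alpha> h + \<delta> + \<bar>\<alpha>\<bar> / (real n)\<^sup>2"
      unfolding F using n0 by (simp add: field_simps)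
  qed auto
  have "0 \<le> ln (N + 1) / (real n)\<^sup>2" "0 \<le> \<bar>\<alpha>\<bar> / (real n)\<^sup>2"
    using N0 by auto
  then show ?thesis
    using upper lower unfolding \<delta>_def[symmetric] add_divide_distrib by linarith
qed

theorem theorem9p2:
  fixes \<alpha> h :: real
  assumes "\<alpha> > -2"
  shows "(\<lambda>n. mf_free_energy n \<alpha> h) \<longlonglongrightarrow> free_energy \<alpha> h"
proof -
  define a where "a n = real n * (real n - 1) / 2 / (real n)\<^sup>2" for n
  have a: "a \<longlonglongrightarrow> 1 / 2"
    unfolding a_def by real_asymp
  have "(\<lambda>n. \<bar>4 * \<alpha> / 3 * a n ^ 3 - \<alpha> / 6\<bar> + (\<bar>h\<bar> + 1) * \<bar>a n - 1 / 2\<bar>)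
      \<longlonglongrightarrow> \<bar>4 * \<alpha> / 3 * (1 / 2) ^ 3 - \<alpha> / 6\<bar> + (\<bar>h\<bar> + 1) * \<bar>1 / 2 - 1 / 2\<bar>"
    by (intro tendsto_intros a)
  then have size: "(\<lambda>n. \<bar>4 * \<alpha> / 3 * a n ^ 3 - \<alpha> / 6\<bar> + (\<bar>h\<bar> + 1) * \<bar>a n - 1 / 2\<bar>)
      \<longlonglongrightarrow> 0"
    by (simp add: power3_eq_cube)
  have log: "(\<lambda>n. (\<bar>\<alpha>\<bar> + ln (real n * (real n - 1) / 2 + 1)) / (real n)\<^sup>2) \<longlonglongrightarrow> 0"
    by real_asymp
  have bound: "eventually (\<lambda>n. norm (mf_free_energy n \<alpha> h - free_energy \<alpha> h)
      \<le> \<bar>4 * \<alpha> / 3 * a n ^ 3 - \<alpha> / 6\<bar> + (\<bar>h\<bar> + 1) * \<bar>a n - 1 / 2\<bar>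
        + (\<bar>\<alpha>\<bar> + ln (real n * (real n - 1) / 2 + 1)) / (real n)\<^sup>2) sequentially"
    using eventually_ge_at_top[of 2]
    by eventually_elim (use mf_free_energy_error in \<open>simp add: a_def\<close>)
  have "(\<lambda>n. mf_free_energy n \<alpha> h - free_energy \<alpha> h) \<longlonglongrightarrow> 0"
    using tendsto_add[OF size log] by (intro Lim_null_comparison[OF bound]) simp
  then show ?thesis
    by (simp add: LIM_zero_iff)
qed

end
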